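(* (1) If $P$ is an ordered set in which every chain is finite, then the lattice of convex subsets $\operatorname{Co}(P)$ is an atomistic, strongly coatomic convex geometry. (2) If $S$ is a meet semilattice that satisfies the ascending chain condition, then the lattice of subsemilattices $\operatorname{Sub}_\wedge(S)$ is an atomistic, strongly coatomic convex geometry.
   Context: A subset $A$ of an ordered set $P$ is convex if $a_1,a_2\in A$ and $a_1\leq x\leq a_2$ imply $x\in A$. $\operatorname{Co}(P)$ is the lattice of all convex subsets of $P$ (including $\emptyset$) ordered by inclusion; it is the lattice of closed sets of the convex hull operator on $P$. $\operatorname{Sub}_\wedge(S)$ is the lattice of all subsets of $S$ closed under binary meet (including $\emptyset$), ordered by inclusion; it is the lattice of closed sets of the subsemilattice-generated-by operator on $S$. A closure system $(X,\gamma)$ (a set $X$ with a closure operator $\gamma$ on its subsets) has the anti-exchange property if for all $x\neq y$ in $X$ and all closed $A\subseteq X$: $x\in\gamma(A\cup\{y\})$ and $x\notin A$ imply $y\notin\gamma(A\cup\{x\})$. A convex geometry is a closure system with $\gamma(\emptyset)=\emptyset$ that has the anti-exchange property. The phrase that the lattice of closed sets "is an atomistic, strongly coatomic convex geometry" means that the corresponding closure system is a convex geometry and that its lattice of closed sets is atomistic and strongly coatomic. A complete lattice is atomistic if every nonzero element is a join of atoms. A lattice is strongly coatomic if whenever $a<c$ there exists $b$ with $a\leq b\prec c$, where $b\prec c$ means $c$ covers $b$. *)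

theory Defs
  imports "HOL-Algebra.Complete_Lattice" "HOL.Hull"
begin

locale closure_system =
  fixes X :: "'a set" and \<gamma> :: "'a set \<Rightarrow> 'a set"
  assumes closure_carrier: "A \<subseteq> X \<Longrightarrow> \<gamma> A \<subseteq> X"
    and closure_extensive: "A \<subseteq> X \<Longrightarrow> A \<subseteq> \<gamma> A"
    and closure_mono: "A \<subseteq> B \<Longrightarrow> B \<subseteq> X \<Longrightarrow> \<gamma> A \<subseteq> \<gamma> B"
    and closure_idem: "A \<subseteq> X \<Longrightarrow> \<gamma> (\<gamma> A) = \<gamma> A"

definition closed_sets :: "'a set \<Rightarrow> ('a set \<Rightarrow> 'a set) \<Rightarrow> 'a set set"
  where "closed_sets X \<gamma> = {A. A \<subseteq> X \<and> \<gamma> A = A}"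

locale anti_exchange = closure_system +
  assumes anti_exchange:
    "\<lbrakk>x \<in> X; y \<in> X; x \<noteq> y; A \<in> closed_sets X \<gamma>; x \<in> \<gamma> (A \<union> {y}); x \<notin> A\<rbrakk>
      \<Longrightarrow> y \<notin> \<gamma> (A \<union> {x})"

locale convex_geometry = anti_exchange +
  assumes closure_empty: "\<gamma> {} = {}"

definition inclusion_order :: "'a set set \<Rightarrow> 'a set gorder"
  where "inclusion_order F = \<lparr>carrier = F, eq = (=), le = (\<subseteq>)\<rparr>"

definition covers :: "('a, 'b) gorder_scheme \<Rightarrow> 'a \<Rightarrow> 'a \<Rightarrow> bool"
  where "covers L c b \<longleftrightarrow> b \<in> carrier L \<and> c \<in> carrier L \<and> b \<sqsubset>\<^bsub>L\<^esub> c \<and>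
    \<not> (\<exists>x\<in>carrier L. b \<sqsubset>\<^bsub>L\<^esub> x \<and> x \<sqsubset>\<^bsub>L\<^esub> c)"

definition atoms :: "('a, 'b) gorder_scheme \<Rightarrow> 'a set"
  where "atoms L = {a. covers L a \<bottom>\<^bsub>L\<^esub>}"

definition atomistic :: "('a, 'b) gorder_scheme \<Rightarrow> bool"
  where "atomistic L \<longleftrightarrow> complete_lattice L \<and>
    (\<forall>x\<in>carrier L. x \<noteq> \<bottom>\<^bsub>L\<^esub> \<longrightarrow> (\<exists>B. B \<subseteq> atoms L \<and> x = \<Squnion>\<^bsub>L\<^esub> B))"

definition strongly_coatomic :: "('a, 'b) gorder_scheme \<Rightarrow> bool"
  where "strongly_coatomic L \<longleftrightarrow> lattice L \<and>
    (\<forall>a\<in>carrier L. \<forall>c\<in>carrier L. a \<sqsubset>\<^bsub>L\<^esub> c \<longrightarrow> (\<exists>b\<in>carrier L. a \<sqsubseteq>\<^bsub>L\<^esub> b \<and> covers L c b))"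

definition convex_subset :: "('a, 'b) gorder_scheme \<Rightarrow> 'a set \<Rightarrow> bool"
  where "convex_subset P A \<longleftrightarrow> A \<subseteq> carrier P \<and>
    (\<forall>a\<^sub>1\<in>A. \<forall>a\<^sub>2\<in>A. \<forall>x\<in>carrier P. a\<^sub>1 \<sqsubseteq>\<^bsub>P\<^esub> x \<and> x \<sqsubseteq>\<^bsub>P\<^esub> a\<^sub>2 \<longrightarrow> x \<in> A)"

definition Co :: "('a, 'b) gorder_scheme \<Rightarrow> 'a set gorder"
  where "Co P = inclusion_order {A. convex_subset P A}"

text \<open>For \<open>A\<close> not contained in the carrier, the values of \<open>convex_hull_in\<close> and
  \<open>subsemilattice_generated\<close> are \<open>UNIV\<close> (an empty intersection);
  only the values on subsets of the carrier are relevant.\<close>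

definition convex_hull_in :: "('a, 'b) gorder_scheme \<Rightarrow> 'a set \<Rightarrow> 'a set"
  where "convex_hull_in P A = convex_subset P hull A"

definition subsemilattice :: "('a, 'b) gorder_scheme \<Rightarrow> 'a set \<Rightarrow> bool"
  where "subsemilattice S A \<longleftrightarrow> A \<subseteq> carrier S \<and> (\<forall>x\<in>A. \<forall>y\<in>A. x \<sqinter>\<^bsub>S\<^esub> y \<in> A)"

definition Sub_meet :: "('a, 'b) gorder_scheme \<Rightarrow> 'a set gorder"
  where "Sub_meet S = inclusion_order {A. subsemilattice S A}"

definition subsemilattice_generated :: "('a, 'b) gorder_scheme \<Rightarrow> 'a set \<Rightarrow> 'a set"
  where "subsemilattice_generated S A = subsemilattice S hull A"

definition every_chain_finite :: "('a, 'b) gorder_scheme \<Rightarrow> bool"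
  where "every_chain_finite P \<longleftrightarrow>
    (\<forall>C. C \<subseteq> carrier P \<and> Complete_Partial_Order.chain (le P) C \<longrightarrow> finite C)"

definition ascending_chain_condition :: "('a, 'b) gorder_scheme \<Rightarrow> bool"
  where "ascending_chain_condition S \<longleftrightarrow>
    (\<forall>f :: nat \<Rightarrow> 'a. (\<forall>i. f i \<in> carrier S) \<and> (\<forall>i. f i \<sqsubseteq>\<^bsub>S\<^esub> f (Suc i)) \<longrightarrow>
      (\<exists>n. \<forall>m\<ge>n. f m = f n))"

definition atomistic_strongly_coatomic_convex_geometry ::
  "'a set gorder \<Rightarrow> 'a set \<Rightarrow> ('a set \<Rightarrow> 'a set) \<Rightarrow> bool"
  where "atomistic_strongly_coatomic_convex_geometry L X \<gamma> \<longleftrightarrow>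
    L = inclusion_order (closed_sets X \<gamma>) \<and> convex_geometry X \<gamma> \<and> atomistic L \<and> strongly_coatomic L"

end

theory Submission
  imports Defs
begin

text \<open>
  Both halves rest on one property of a family \<open>K\<close> of subsets of \<open>X\<close> that is closed under
  intersections: whenever \<open>A \<subset> C\<close> are members, some \<open>z \<in> C - A\<close> can be removed from \<open>C\<close> so that
  \<open>C - {z}\<close> is still a member. Call this the removal property (such a \<open>z\<close> is an extreme point
  of \<open>C\<close>).

  Strong coatomicity is immediate, since \<open>C - {z}\<close> contains \<open>A\<close> and is covered by \<open>C\<close>. The removal
  property also forces anti-exchange. If \<open>A\<close> together with \<open>x\<close> and \<open>A\<close> together with \<open>y\<close> generate
  the same closed set \<open>C\<close>, where \<open>x, y \<notin> A\<close>, remove a point \<open>z \<notin> A\<close> from \<open>C\<close>. A point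
  other than \<open>x\<close> cannot be removed, because the smaller closed set would still contain \<open>A\<close> and
  \<open>x\<close>; for the same reason \<open>z = y\<close>, and so \<open>x = y\<close>. Atomisticity only needs the empty set
  and the singletons to be closed. All this is \<open>convex_geometry_from_removal\<close> below.

  It remains to find removable points. A maximal or a minimal element of a convex set can be removed.
  If all of those of \<open>C\<close> lie in \<open>A\<close>, then, chains being finite, every element of \<open>C\<close> lies between two
  elements of \<open>A\<close>, so \<open>A = C\<close>. In a meet semilattice with the ascending chain condition, take \<open>z\<close>
  maximal in \<open>C - A\<close>: a meet of two elements of \<open>C\<close> other than \<open>z\<close> cannot equal \<open>z\<close>, for both would
  lie strictly above \<open>z\<close>, hence in \<open>A\<close>, and so would their meet.
\<close>

section \<open>Families of sets with removable points\<close>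

lemma inclusion_order_simps [simp]:
  "carrier (inclusion_order F) = F"
  "A \<sqsubseteq>\<^bsub>inclusion_order F\<^esub> B \<longleftrightarrow> A \<subseteq> B"
  "A \<sqsubset>\<^bsub>inclusion_order F\<^esub> B \<longleftrightarrow> A \<subset> B"
  by (auto simp: inclusion_order_def lless_def)

lemma partial_order_inclusion_order: "partial_order (inclusion_order F)"
  by unfold_locales (auto simp: inclusion_order_def)

locale removal_family =
  fixes X :: "'a set" and K :: "'a set \<Rightarrow> bool"
  assumes member_subset: "K A \<Longrightarrow> A \<subseteq> X"
    and carrier_member: "K X"
    and Inter_member: "F \<noteq> {} \<Longrightarrow> (\<And>A. A \<in> F \<Longrightarrow> K A) \<Longrightarrow> K (\<Inter>F)"
    and empty_member: "K {}"
    and singleton_member: "x \<in> X \<Longrightarrow> K {x}"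
    and removal: "K A \<Longrightarrow> K C \<Longrightarrow> A \<subset> C \<Longrightarrow> \<exists>z\<in>C - A. K (C - {z})"
begin

lemma hull_member:
  assumes "A \<subseteq> X"
  shows "K (K hull A)"
  unfolding hull_def by (rule Inter_member) (use assms carrier_member in auto)

lemma closed_sets_hull: "closed_sets X (\<lambda>A. K hull A) = {A. K A}"
  unfolding closed_sets_def using member_subset hull_same hull_member by (metis (lifting))

lemma closure_system_hull: "closure_system X (\<lambda>A. K hull A)"
proof
  show "K hull A \<subseteq> X" if "A \<subseteq> X" for A
    using that carrier_member by (rule hull_minimal)
qed (rule hull_subset, rule hull_mono, assumption, rule hull_hull)

text \<open>
  If the conclusion failed, \<open>x\<close> and \<open>y\<close> would generate the same closed set over \<open>A\<close>. A removable
  point of that set outside \<open>A\<close> must coincide with every point that generates it over \<open>A\<close>.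
\<close>

lemma anti_exchange_hull:
  assumes "x \<in> X" "y \<in> X" "x \<noteq> y" "K A" "x \<notin> A"
    and x: "x \<in> K hull (A \<union> {y})"
  shows "y \<notin> K hull (A \<union> {x})"
proof
  assume y: "y \<in> K hull (A \<union> {x})"
  define C where "C = K hull (A \<union> {x})"
  have AX: "A \<subseteq> X"
    using member_subset \<open>K A\<close> by blast
  have C: "K C"
    unfolding C_def using AX \<open>x \<in> X\<close> by (intro hull_member) auto
  have AC: "A \<union> {x} \<subseteq> C"
    unfolding C_def by (rule hull_subset)
  have C_eq: "C = K hull (A \<union> {y})"
  proof
    show "C \<subseteq> K hull (A \<union> {y})"
      unfolding C_def
    proof (rule hull_minimal)
      show "A \<union> {x} \<subseteq> K hull (A \<union> {y})"
        using x hull_subset[of "A \<union> {y}" K] by auto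
      show "K (K hull (A \<union> {y}))"
        using AX \<open>y \<in> X\<close> by (intro hull_member) auto
    qed
    show "K hull (A \<union> {y}) \<subseteq> C"
      using C AC y by (intro hull_minimal) (auto simp: C_def)
  qed
  obtain z where z: "z \<in> C" "z \<notin> A" "K (C - {z})"
    using removal[OF \<open>K A\<close> C] AC \<open>x \<notin> A\<close> by blast
  have generator: "z = w" if "C = K hull (A \<union> {w})" for w
  proof (rule ccontr)
    assume "z \<noteq> w"
    then have "A \<union> {w} \<subseteq> C - {z}"
      using that AC z hull_subset[of "A \<union> {w}" K] by auto
    with z(3) have "C \<subseteq> C - {z}"
      unfolding that by (intro hull_minimal)
    with \<open>z \<in> C\<close> show False by blast
  qed
  have "z = x"
    by (rule generator) (rule C_def)
  moreover have "z = y"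
    by (rule generator) (rule C_eq)
  ultimately show False
    using \<open>x \<noteq> y\<close> by simp
qed

lemma convex_geometry_hull: "convex_geometry X (\<lambda>A. K hull A)"
proof -
  interpret closure_system X "\<lambda>A. K hull A"
    by (rule closure_system_hull)
  show ?thesis
  proof
    show "K hull {} = {}"
      using empty_member by (rule hull_same)
    show "y \<notin> K hull (A \<union> {x})"
      if "x \<in> X" "y \<in> X" "x \<noteq> y" "A \<in> closed_sets X (\<lambda>A. K hull A)"
        "x \<in> K hull (A \<union> {y})" "x \<notin> A" for x y A
      using that by (intro anti_exchange_hull) (auto simp: closed_sets_hull)
  qed
qed

abbreviation L :: "'a set gorder"
  where "L \<equiv> inclusion_order {A. K A}"

lemma complete_lattice_members: "complete_lattice L"
proof -
  interpret partial_order L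
    by (rule partial_order_inclusion_order)
  show ?thesis
  proof
    fix F
    assume "F \<subseteq> carrier L"
    then have F: "\<And>A. A \<in> F \<Longrightarrow> K A"
      by auto
    have "\<Union>F \<subseteq> X"
      using F member_subset by blast
    have "least L (K hull \<Union>F) (Upper L F)"
    proof (rule least_UpperI)
      show "A \<sqsubseteq>\<^bsub>L\<^esub> K hull \<Union>F" if "A \<in> F" for A
        using that hull_subset[of "\<Union>F" K] by auto
      show "K hull \<Union>F \<sqsubseteq>\<^bsub>L\<^esub> B" if "B \<in> Upper L F" for B
      proof -
        from that F have "\<Union>F \<subseteq> B" "K B"
          by (auto simp: Upper_def)
        then show ?thesis
          by (simp add: hull_minimal)
      qed
      show "K hull \<Union>F \<in> carrier L"
        using hull_member[OF \<open>\<Union>F \<subseteq> X\<close>] by simp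
    qed fact
    then show "\<exists>s. least L s (Upper L F)" ..
    \<comment> \<open>Inserting \<open>X\<close> gives the right value \<open>X\<close> for the infimum of the empty family.\<close>
    have "K (\<Inter>(insert X F))"
      using F carrier_member by (intro Inter_member) auto
    then have "greatest L (\<Inter>(insert X F)) (Lower L F)"
      using F member_subset by (intro greatest_LowerI) (auto simp: Lower_def)
    then show "\<exists>i. greatest L i (Lower L F)" ..
  qed
qed

lemma bottom_members: "\<bottom>\<^bsub>L\<^esub> = {}"
  unfolding bottom_def by (rule some_equality) (use empty_member in \<open>auto simp: least_def\<close>)

lemma singleton_atom: "x \<in> X \<Longrightarrow> {x} \<in> atoms L"
  using singleton_member empty_member by (auto simp: atoms_def covers_def bottom_members)

lemma Sup_singletons:
  assumes "K A"
  shows "\<Squnion>\<^bsub>L\<^esub> ((\<lambda>x. {x}) ` A) = A"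
proof -
  have sing: "K {x}" if "x \<in> A" for x
    using that assms member_subset singleton_member by blast
  have lub: "least L A (Upper L ((\<lambda>x. {x}) ` A))"
  proof (rule least_UpperI)
    show "A \<sqsubseteq>\<^bsub>L\<^esub> B" if "B \<in> Upper L ((\<lambda>x. {x}) ` A)" for B
      using that sing by (auto simp: Upper_def)
  qed (use assms sing in auto)
  then show ?thesis
    unfolding sup_def
    by (rule some_equality) (rule partial_order.least_unique[OF partial_order_inclusion_order _ lub])
qed

lemma atomistic_members: "atomistic L"
  unfolding atomistic_def
proof (intro conjI ballI impI)
  fix A
  assume "A \<in> carrier L"
  then have "K A"
    by simp
  then have "(\<lambda>x. {x}) ` A \<subseteq> atoms L"
    using member_subset singleton_atom by blast
  with Sup_singletons[OF \<open>K A\<close>] show "\<exists>B. B \<subseteq> atoms L \<and> A = \<Squnion>\<^bsub>L\<^esub> B"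
    by metis
qed (rule complete_lattice_members)

lemma strongly_coatomic_members: "strongly_coatomic L"
  unfolding strongly_coatomic_def
proof (intro conjI ballI impI)
  show "lattice L"
    using complete_lattice_members by simp
  fix A C
  assume "A \<in> carrier L" "C \<in> carrier L" "A \<sqsubset>\<^bsub>L\<^esub> C"
  then obtain z where z: "z \<in> C" "z \<notin> A" "K (C - {z})" and "K C" "A \<subset> C"
    using removal[of A C] by auto
  then show "\<exists>B\<in>carrier L. A \<sqsubseteq>\<^bsub>L\<^esub> B \<and> covers L C B"
    by (intro bexI[of _ "C - {z}"]) (auto simp: covers_def)
qed

theorem convex_geometry_from_removal:
  "atomistic_strongly_coatomic_convex_geometry L X (\<lambda>A. K hull A)"
  unfolding atomistic_strongly_coatomic_convex_geometry_def closed_sets_hull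
  using convex_geometry_hull atomistic_members strongly_coatomic_members by blast

end

section \<open>Maximal elements from chain conditions\<close>

context partial_order
begin

lemma maximal_above_of_acc:
  assumes acc: "ascending_chain_condition L" and U: "U \<subseteq> carrier L" and p: "p \<in> U"
  obtains m where "m \<in> U" "p \<sqsubseteq> m" "\<And>y. y \<in> U \<Longrightarrow> m \<sqsubseteq> y \<Longrightarrow> y = m"
proof -
  have "\<exists>m\<in>U. p \<sqsubseteq> m \<and> (\<forall>y\<in>U. m \<sqsubseteq> y \<longrightarrow> y = m)"
  proof (rule ccontr)
    assume no_max: "\<not> ?thesis"
    have step: "\<exists>y. (y \<in> U \<and> p \<sqsubseteq> y) \<and> (m \<sqsubseteq> y \<and> y \<noteq> m)" if "m \<in> U \<and> p \<sqsubseteq> m" for m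
      using that no_max U p le_trans by (meson subsetD)
    have "\<exists>f. \<forall>n::nat. (f n \<in> U \<and> p \<sqsubseteq> f n) \<and> (f n \<sqsubseteq> f (Suc n) \<and> f (Suc n) \<noteq> f n)"
    proof (rule dependent_nat_choice)
      show "\<exists>x. x \<in> U \<and> p \<sqsubseteq> x"
        using U p le_refl by blast
    qed (rule step)
    then obtain f :: "nat \<Rightarrow> 'a" where f: "\<And>n. f n \<in> U"
        "\<And>n. f n \<sqsubseteq> f (Suc n)" "\<And>n. f (Suc n) \<noteq> f n"
      by blast
    then obtain n where "\<forall>m\<ge>n. f m = f n"
      using acc U unfolding ascending_chain_condition_def by (meson subsetD)
    with f(3)[of n] show False
      by (metis le_SucI order_refl)
  qed
  then show thesis
    using that by blast
qed

text \<open>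
  An ascending sequence with finite range takes some value \<open>v\<close> infinitely often, and between two
  occurrences of \<open>v\<close> it is squeezed to \<open>v\<close>.
\<close>

lemma acc_of_every_chain_finite:
  assumes "every_chain_finite L"
  shows "ascending_chain_condition L"
  unfolding ascending_chain_condition_def
proof (intro allI impI, elim conjE)
  fix f :: "nat \<Rightarrow> 'a"
  assume carr: "\<forall>i. f i \<in> carrier L" and asc: "\<forall>i. f i \<sqsubseteq> f (Suc i)"
  have mono: "f i \<sqsubseteq> f j" if "i \<le> j" for i j
    using that
  proof (induction rule: dec_induct)
    case base
    show ?case
      using carr by simp
  next
    case (step j)
    then show ?case
      using carr asc le_trans[of "f i" "f j" "f (Suc j)"] by simp
  qed
  have "f i \<sqsubseteq> f j \<or> f j \<sqsubseteq> f i" for i j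
    using mono[of i j] mono[of j i] by linarith
  then have "Complete_Partial_Order.chain (le L) (range f)"
    by (auto simp: chain_def)
  then have "finite (range f)"
    using assms carr unfolding every_chain_finite_def by blast
  then obtain n where inf: "infinite {m. f m = f n}"
    using pigeonhole_infinite[of "UNIV :: nat set" f] by auto
  have "f m = f n" if "n \<le> m" for m
  proof -
    obtain k where "m \<le> k" "f k = f n"
      using inf by (auto simp: finite_nat_set_iff_bounded not_less)
    then show ?thesis
      using mono[OF that] mono[of m k] carr by (simp add: le_antisym)
  qed
  then show "\<exists>n. \<forall>m\<ge>n. f m = f n"
    by blast
qed

end

lemma every_chain_finite_dual:
  assumes "every_chain_finite P"
  shows "every_chain_finite (inv_gorder P)"
  using assms unfolding every_chain_finite_def chain_def by (auto; blast)

section \<open>Convex subsets\<close>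

lemma convex_subset_dual: "convex_subset (inv_gorder P) A \<longleftrightarrow> convex_subset P A"
  unfolding convex_subset_def by auto

lemma convex_subset_remove_maximal:
  assumes "convex_subset P C" and "m \<in> C" and "\<And>y. y \<in> C \<Longrightarrow> m \<sqsubseteq>\<^bsub>P\<^esub> y \<Longrightarrow> y = m"
  shows "convex_subset P (C - {m})"
  using assms unfolding convex_subset_def by blast

text \<open>The minimal points are handled by passing to the dual order, which has the same convex sets.\<close>

lemma convex_subset_removal:
  assumes "partial_order P" and fin: "every_chain_finite P"
    and A: "convex_subset P A" and C: "convex_subset P C" and "A \<subset> C"
  shows "\<exists>z\<in>C - A. convex_subset P (C - {z})"
proof -
  interpret partial_order P
    by fact
  interpret dual: partial_order "inv_gorder P"
    by (rule dual_order)
  have CP: "C \<subseteq> carrier P"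
    using C by (simp add: convex_subset_def)
  obtain p where p: "p \<in> C" "p \<notin> A"
    using \<open>A \<subset> C\<close> by blast
  obtain u where u: "u \<in> C" "p \<sqsubseteq>\<^bsub>P\<^esub> u" "\<And>y. y \<in> C \<Longrightarrow> u \<sqsubseteq>\<^bsub>P\<^esub> y \<Longrightarrow> y = u"
    using maximal_above_of_acc[OF acc_of_every_chain_finite[OF fin] CP p(1)] by blast
  obtain l where l: "l \<in> C" "l \<sqsubseteq>\<^bsub>P\<^esub> p" "\<And>y. y \<in> C \<Longrightarrow> y \<sqsubseteq>\<^bsub>P\<^esub> l \<Longrightarrow> y = l"
    using dual.maximal_above_of_acc[OF
        dual.acc_of_every_chain_finite[OF every_chain_finite_dual[OF fin]], of C p] CP p(1)
    by auto
  have "u \<notin> A \<or> l \<notin> A"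
    using A p u(2) l(2) CP unfolding convex_subset_def by blast
  moreover have "convex_subset P (C - {u})"
    using C u(1,3) by (rule convex_subset_remove_maximal)
  moreover have "convex_subset P (C - {l})"
    using convex_subset_remove_maximal[of "inv_gorder P" C l] C l(1,3)
    by (simp add: convex_subset_dual)
  ultimately show ?thesis
    using u(1) l(1) by blast
qed

lemma removal_family_convex_subset:
  assumes "partial_order P" "every_chain_finite P"
  shows "removal_family (carrier P) (convex_subset P)"
proof
  interpret partial_order P
    by fact
  show "convex_subset P {x}" if "x \<in> carrier P" for x
    using that by (auto simp: convex_subset_def)
  show "convex_subset P (\<Inter>F)" if "F \<noteq> {}" "\<And>A. A \<in> F \<Longrightarrow> convex_subset P A" for F
    using that unfolding convex_subset_def by blast
  show "\<exists>z\<in>C - A. convex_subset P (C - {z})"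
    if "convex_subset P A" "convex_subset P C" "A \<subset> C" for A C
    using assms that by (rule convex_subset_removal)
qed (auto simp: convex_subset_def)

section \<open>Subsemilattices\<close>

lemma subsemilattice_removal:
  assumes "lower_semilattice S" and acc: "ascending_chain_condition S"
    and A: "subsemilattice S A" and C: "subsemilattice S C" and "A \<subset> C"
  shows "\<exists>z\<in>C - A. subsemilattice S (C - {z})"
proof -
  interpret lower_semilattice S
    by fact
  have CS: "C \<subseteq> carrier S"
    using C by (simp add: subsemilattice_def)
  obtain p where p: "p \<in> C - A"
    using \<open>A \<subset> C\<close> by blast
  have sub: "C - A \<subseteq> carrier S"
    using CS by blast
  obtain z where z: "z \<in> C - A"
    and max: "\<And>y. y \<in> C - A \<Longrightarrow> z \<sqsubseteq>\<^bsub>S\<^esub> y \<Longrightarrow> y = z"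
    using maximal_above_of_acc[OF acc sub p] by metis
  have "x \<sqinter>\<^bsub>S\<^esub> y \<noteq> z" if "x \<in> C - {z}" "y \<in> C - {z}" for x y
  proof
    assume xy: "x \<sqinter>\<^bsub>S\<^esub> y = z"
    have "x \<in> carrier S" "y \<in> carrier S"
      using that CS by auto
    then have "z \<sqsubseteq>\<^bsub>S\<^esub> x" "z \<sqsubseteq>\<^bsub>S\<^esub> y"
      using meet_left meet_right xy by blast+
    then have "x \<in> A" "y \<in> A"
      using that max by auto
    then have "z \<in> A"
      using A xy unfolding subsemilattice_def by blast
    with z show False by simp
  qed
  then have "subsemilattice S (C - {z})"
    using C unfolding subsemilattice_def by blast
  with z show ?thesis by blast
qed

lemma removal_family_subsemilattice:
  assumes "lower_semilattice S" "ascending_chain_condition S"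
  shows "removal_family (carrier S) (subsemilattice S)"
proof
  interpret lower_semilattice S
    by fact
  show "subsemilattice S (carrier S)"
    by (simp add: subsemilattice_def)
  show "subsemilattice S {x}" if "x \<in> carrier S" for x
  proof -
    have "x \<sqinter>\<^bsub>S\<^esub> x = x"
      using that by (intro le_antisym meet_le meet_left) auto
    with that show ?thesis
      by (simp add: subsemilattice_def)
  qed
  show "subsemilattice S (\<Inter>F)" if "F \<noteq> {}" "\<And>A. A \<in> F \<Longrightarrow> subsemilattice S A" for F
    using that unfolding subsemilattice_def by blast
  show "\<exists>z\<in>C - A. subsemilattice S (C - {z})"
    if "subsemilattice S A" "subsemilattice S C" "A \<subset> C" for A C
    using assms that by (rule subsemilattice_removal)
qed (auto simp: subsemilattice_def)

section \<open>Convex sets and subsemilattices form convex geometries\<close>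

theorem theorem14:
  fixes P :: "('a, 'b) gorder_scheme" and S :: "('c, 'd) gorder_scheme"
  shows "(partial_order P \<and> every_chain_finite P \<longrightarrow>
      atomistic_strongly_coatomic_convex_geometry (Co P) (carrier P) (convex_hull_in P))
    \<and> (lower_semilattice S \<and> ascending_chain_condition S \<longrightarrow>
      atomistic_strongly_coatomic_convex_geometry (Sub_meet S) (carrier S) (subsemilattice_generated S))"
proof (intro conjI impI; elim conjE)
  assume "partial_order P" "every_chain_finite P"
  then interpret removal_family "carrier P" "convex_subset P"
    by (rule removal_family_convex_subset)
  show "atomistic_strongly_coatomic_convex_geometry (Co P) (carrier P) (convex_hull_in P)"
    using convex_geometry_from_removal unfolding Co_def convex_hull_in_def[abs_def] .
next
  assume "lower_semilattice S" "ascending_chain_condition S"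
  then interpret removal_family "carrier S" "subsemilattice S"
    by (rule removal_family_subsemilattice)
  show "atomistic_strongly_coatomic_convex_geometry (Sub_meet S) (carrier S)
      (subsemilattice_generated S)"
    using convex_geometry_from_removal unfolding Sub_meet_def subsemilattice_generated_def[abs_def] .
qed

end
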